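(* Let $G_3 = \langle g_1, g_2, g_3 \mid g_2g_1 = g_1^{-1}g_2,\ g_3g_1 = g_1^{-1}g_3,\ g_3g_2 = g_2g_3 \rangle$. Set \[ \mathcal{A} = \left\{ \begin{bmatrix} 2k & 2m+1 \\ 2l+1 & 2n \end{bmatrix} \in \mathrm{GL}(2,\mathbb{Z}) : k,l,m,n \in \mathbb{Z} \right\}, \qquad \mathcal{B} = \left\{ \begin{bmatrix} 2k+1 & 2m \\ 2l & 2n+1 \end{bmatrix} \in \mathrm{GL}(2,\mathbb{Z}) : k,l,m,n \in \mathbb{Z} \right\}, \] and for $a \in \mathbb{Z}$ and $M \in \mathcal{A}\cup\mathcal{B}$, set (in $1+2$ block form) \[ \alpha_{a,M} = \left[\begin{array}{cc} 1 & \begin{matrix} a & a \end{matrix} \\ \begin{matrix} 0 \\ 0 \end{matrix} & M \end{array}\right], \qquad \beta_{a,M} = \left[\begin{array}{cc} -1 & \begin{matrix} a & a \end{matrix} \\ \begin{matrix} 0 \\ 0 \end{matrix} & M \end{array}\right]. \] Then \begin{align*} \mathrm{Aut}(G_3) &= \{ \alpha_{a,A}, \alpha_{a,B}, \beta_{a,A}, \beta_{a,B} \mid a \in \mathbb{Z}, A \in \mathcal{A}, B \in \mathcal{B} \}, \\ \mathrm{Inn}(G_3) &= \{ \alpha_{2a,I_2}, \beta_{2a,I_2} \mid a \in \mathbb{Z} \}, \\ \mathrm{Out}(G_3) &= \{ [\alpha_{0,A}], [\alpha_{1,A}], [\alpha_{0,B}], [\alpha_{1,B}] \mid A \in \mathcal{A},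 B \in \mathcal{B} \}. \end{align*} Moreover, the composition in $\mathrm{Out}(G_3)$ is given, for $M,M' \in \mathcal{A}\cup\mathcal{B}$, by \begin{align*} [\alpha_{0,M}]\circ[\alpha_{0,M'}] &= [\alpha_{0,MM'}], & [\alpha_{0,M}]\circ[\alpha_{1,M'}] &= [\alpha_{1,MM'}], \\ [\alpha_{1,M}]\circ[\alpha_{0,M'}] &= [\alpha_{1,MM'}], & [\alpha_{1,M}]\circ[\alpha_{1,M'}] &= [\alpha_{0,MM'}]. \end{align*}
   Context: The group $G_3$ is $G_2 \rtimes_{\overline{\varphi}_2} \mathbb{Z}$, where $G_2 = \langle g_1, g_2 \mid g_2g_1=g_1^{-1}g_2\rangle$, $\varphi_2 \in \mathrm{Aut}(G_2)$ is given by $\varphi_2(g_1)=g_1^{-1}$, $\varphi_2(g_2)=g_2$, and the generator $g_3$ of $\mathbb{Z}$ acts by $g_3 h g_3^{-1} = \varphi_2(h)$. Every element of $G_3$ is written uniquely as $g_1^{e_1}g_2^{e_2}g_3^{e_3}$ with $e_i \in \mathbb{Z}$. Matrix notation: a $3\times 3$ integer matrix $(a_{i,j})$ denotes the map $\varphi$ of $G_3$ determined on generators by $\varphi(g_j) = g_1^{a_{1,j}} g_2^{a_{2,j}} g_3^{a_{3,j}}$ for $j=1,2,3$ (the $j$-th column lists the exponents of the image of $g_j$). $I_2$ is the $2\times 2$ identity matrix. $\mathrm{Inn}(G)$ is the group of inner automorphisms, $\mathrm{Out}(G)=\mathrm{Aut}(G)/\mathrm{Inn}(G)$, and $[\varphi]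 = \mathrm{Inn}(G)\varphi$ is the class of $\varphi$ in $\mathrm{Out}(G)$. *)

theory Defs
  imports "HOL-Analysis.Determinants" "HOL-Algebra.Bij" "HOL-Algebra.Coset"
begin

section \<open>Groups given by generators and relations\<close>

datatype 'a letter = Pos 'a | Neg 'a

type_synonym 'a word = "'a letter list"

text \<open>A pair \<open>(u, v)\<close> of words in \<open>R\<close> stands for the relation \<open>u = v\<close>. Two words are equivalent
  iff they represent the same element of the group with generators \<open>'a\<close> and relations \<open>R\<close>.\<close>

inductive word_equiv :: "('a word \<times> 'a word) set \<Rightarrow> 'a word \<Rightarrow> 'a word \<Rightarrow> bool"
  for R where
  refl: "word_equiv R u u"
| sym: "word_equiv R u v \<Longrightarrow> word_equiv R v u"
| trans: "word_equiv R u v \<Longrightarrow> word_equiv R v w \<Longrightarrow> word_equiv R u w"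
| cancel_Pos_Neg: "word_equiv R (u @ [Pos x, Neg x] @ v) (u @ v)"
| cancel_Neg_Pos: "word_equiv R (u @ [Neg x, Pos x] @ v) (u @ v)"
| relation: "(r, s) \<in> R \<Longrightarrow> word_equiv R (u @ r @ v) (u @ s @ v)"

definition word_class :: "('a word \<times> 'a word) set \<Rightarrow> 'a word \<Rightarrow> 'a word set" where
  "word_class R w = {v. word_equiv R w v}"

definition presented_group :: "('a word \<times> 'a word) set \<Rightarrow> 'a word set monoid" where
  "presented_group R =
    \<lparr>carrier = range (word_class R),
     monoid.mult = (\<lambda>X Y. \<Union>u\<in>X. \<Union>v\<in>Y. word_class R (u @ v)),
     one = word_class R []\<rparr>"

lemma word_equiv_append:
  assumes "word_equiv R u u'" "word_equiv R v v'"
  shows "word_equiv R (u @ v) (u' @ v')"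
proof -
  have left: "word_equiv R (p @ a @ q) (p @ b @ q)" if "word_equiv R a b" for p q a b
    using that
  proof (induction rule: word_equiv.induct)
    case (refl u)
    show ?case by (rule word_equiv.refl)
  next
    case (sym u v)
    then show ?case by (simp add: word_equiv.sym)
  next
    case (trans u v w)
    then show ?case using word_equiv.trans by blast
  next
    case (cancel_Pos_Neg u x v)
    show ?case using word_equiv.cancel_Pos_Neg[of R "p @ u" x "v @ q"] by simp
  next
    case (cancel_Neg_Pos u x v)
    show ?case using word_equiv.cancel_Neg_Pos[of R "p @ u" x "v @ q"] by simp
  next
    case (relation r s u v)
    then show ?case using word_equiv.relation[of r s R "p @ u" "v @ q"] by simp
  qed
  show ?thesis
    using left[OF assms(1), of "[]" v] left[OF assms(2), of u' "[]"] word_equiv.trans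
    unfolding append_Nil append_Nil2 by blast
qed

lemma word_class_eq_iff: "word_class R u = word_class R v \<longleftrightarrow> word_equiv R u v"
  unfolding word_class_def set_eq_iff mem_Collect_eq
  by (meson word_equiv.refl word_equiv.sym word_equiv.trans)

lemma presented_group_mult:
  "word_class R u \<otimes>\<^bsub>presented_group R\<^esub> word_class R v = word_class R (u @ v)"
proof -
  have "word_class R (u' @ v') = word_class R (u @ v)"
    if "u' \<in> word_class R u" "v' \<in> word_class R v" for u' v'
    using that
    by (simp add: word_class_eq_iff) (simp add: word_class_def word_equiv_append word_equiv.sym)
  moreover have "u \<in> word_class R u" "v \<in> word_class R v"
    by (simp_all add: word_class_def word_equiv.refl)
  ultimately have "(\<Union>u'\<in>word_class R u. \<Union>v'\<in>word_class R v. word_class R (u' @ v'))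
      = word_class R (u @ v)"
    by blast
  then show ?thesis
    by (simp add: presented_group_def)
qed

fun inv_letter :: "'a letter \<Rightarrow> 'a letter" where
  "inv_letter (Pos x) = Neg x"
| "inv_letter (Neg x) = Pos x"

lemma word_equiv_left_inverse: "word_equiv R (rev (map inv_letter w) @ w) []"
proof (induction w)
  case (Cons l w)
  have "word_equiv R (rev (map inv_letter w) @ [inv_letter l, l] @ w) (rev (map inv_letter w) @ w)"
    by (cases l) (simp_all only: inv_letter.simps word_equiv.cancel_Pos_Neg word_equiv.cancel_Neg_Pos)
  from word_equiv.trans[OF this Cons.IH] show ?case
    by simp
qed (simp add: word_equiv.refl)

lemma carrier_presented_group: "carrier (presented_group R) = range (word_class R)"
  by (simp add: presented_group_def)

lemma one_presented_group: "\<one>\<^bsub>presented_group R\<^esub> = word_class R []"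
  by (simp add: presented_group_def)

lemma group_presented_group: "group (presented_group R)"
proof (rule groupI)
  fix x assume "x \<in> carrier (presented_group R)"
  then obtain w where "x = word_class R w"
    by (auto simp: carrier_presented_group)
  then have "word_class R (rev (map inv_letter w)) \<otimes>\<^bsub>presented_group R\<^esub> x = \<one>\<^bsub>presented_group R\<^esub>"
    by (simp add: presented_group_mult one_presented_group word_class_eq_iff word_equiv_left_inverse)
  then show "\<exists>y\<in>carrier (presented_group R). y \<otimes>\<^bsub>presented_group R\<^esub> x = \<one>\<^bsub>presented_group R\<^esub>"
    by (auto simp: carrier_presented_group)
qed (auto simp: carrier_presented_group one_presented_group presented_group_mult)


section \<open>The group \<open>G\<^sub>3\<close> and its endomorphisms\<close>

text \<open>The generators are indexed by the type \<open>3\<close>, which also indexes the rows and columns of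
  \<open>3 \<times> 3\<close> matrices.\<close>

definition G3_rels :: "(3 word \<times> 3 word) set" where
  "G3_rels =
    {([Pos 2, Pos 1], [Neg 1, Pos 2]),
     ([Pos 3, Pos 1], [Neg 1, Pos 3]),
     ([Pos 3, Pos 2], [Pos 2, Pos 3])}"

definition G3 :: "3 word set monoid" where
  "G3 = presented_group G3_rels"

definition gen :: "3 \<Rightarrow> 3 word set" where
  "gen j = word_class G3_rels [Pos j]"

text \<open>Column \<open>j\<close> of the matrix lists the exponents of the image of \<open>g\<^sub>j\<close>. Endomorphisms are taken
  extensional, as in \<^const>\<open>auto\<close>. The result is only meaningful if some endomorphism has the
  prescribed values on the generators; it is then unique.\<close>

definition endo :: "int^3^3 \<Rightarrow> 3 word set \<Rightarrow> 3 word set" where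
  "endo C = (THE \<phi>. \<phi> \<in> hom G3 G3 \<inter> extensional (carrier G3) \<and>
    (\<forall>j. \<phi> (gen j) =
      gen 1 [^]\<^bsub>G3\<^esub> (C $ 1 $ j) \<otimes>\<^bsub>G3\<^esub> gen 2 [^]\<^bsub>G3\<^esub> (C $ 2 $ j) \<otimes>\<^bsub>G3\<^esub> gen 3 [^]\<^bsub>G3\<^esub> (C $ 3 $ j)))"


section \<open>Inner and outer automorphisms\<close>

definition Inn :: "('a, 'b) monoid_scheme \<Rightarrow> ('a \<Rightarrow> 'a) set" where
  "Inn G = {\<lambda>x\<in>carrier G. g \<otimes>\<^bsub>G\<^esub> x \<otimes>\<^bsub>G\<^esub> inv\<^bsub>G\<^esub> g | g. g \<in> carrier G}"

definition Out :: "('a, 'b) monoid_scheme \<Rightarrow> ('a \<Rightarrow> 'a) set monoid" where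
  "Out G = AutoGroup G Mod Inn G"

definition out_class :: "('a, 'b) monoid_scheme \<Rightarrow> ('a \<Rightarrow> 'a) \<Rightarrow> ('a \<Rightarrow> 'a) set" where
  "out_class G \<phi> = Inn G #>\<^bsub>AutoGroup G\<^esub> \<phi>"


section \<open>The families of matrices\<close>

text \<open>Over \<^typ>\<open>int\<close>, \<^const>\<open>invertible\<close> asks for an integral inverse, so that
  \<open>{M :: int^2^2. invertible M}\<close> is \<open>GL(2, \<int>)\<close>.\<close>

definition matsA :: "(int^2^2) set" where
  "matsA = {M. invertible M \<and>
    (\<exists>k l m n. M = vector [vector [2 * k, 2 * m + 1], vector [2 * l + 1, 2 * n]])}"

definition matsB :: "(int^2^2) set" where
  "matsB = {M. invertible M \<and>
    (\<exists>k l m n. M = vector [vector [2 * k + 1, 2 * m], vector [2 * l, 2 * n + 1]])}"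

definition alpha_mat :: "int \<Rightarrow> int^2^2 \<Rightarrow> int^3^3" where
  "alpha_mat a M = vector
    [vector [1, a, a],
     vector [0, M $ 1 $ 1, M $ 1 $ 2],
     vector [0, M $ 2 $ 1, M $ 2 $ 2]]"

definition beta_mat :: "int \<Rightarrow> int^2^2 \<Rightarrow> int^3^3" where
  "beta_mat a M = vector
    [vector [-1, a, a],
     vector [0, M $ 1 $ 1, M $ 1 $ 2],
     vector [0, M $ 2 $ 1, M $ 2 $ 2]]"

definition \<alpha> :: "int \<Rightarrow> int^2^2 \<Rightarrow> 3 word set \<Rightarrow> 3 word set" where
  "\<alpha> a M = endo (alpha_mat a M)"

definition \<beta> :: "int \<Rightarrow> int^2^2 \<Rightarrow> 3 word set \<Rightarrow> 3 word set" where
  "\<beta> a M = endo (beta_mat a M)"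

end

theory Submission
  imports Defs
begin

text \<open>\<open>G\<^sub>3\<close> is \<open>\<int> \<rtimes> \<int>\<^sup>2\<close>, where \<open>(b, c)\<close> acts on \<open>\<int>\<close> by the sign \<open>(-1)\<^bsup>b + c\<^esup>\<close>. An injective
  endomorphism sends \<open>g\<^sub>1\<close>, which is conjugate to its inverse, to \<open>g\<^sub>1\<^bsup>e\<^esup>\<close>; the relations
  then force the images of \<open>g\<^sub>2\<close> and \<open>g\<^sub>3\<close> to invert \<open>g\<^sub>1\<close> (odd column sums) and to have the same exponent
  \<open>a\<close> of \<open>g\<^sub>1\<close>. Writing \<open>(e, a, M)\<close> for such a map, composition is
  \<open>(e, a, M) \<circ> (f, b, N) = (e f, a + e b, M N)\<close>, and the inner automorphisms are the
  \<open>(\<plusminus>1, 2 a, I)\<close>.\<close>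

section \<open>Homomorphisms from a presented group\<close>

primrec letter_eval :: "('b, 'c) monoid_scheme \<Rightarrow> ('a \<Rightarrow> 'b) \<Rightarrow> 'a letter \<Rightarrow> 'b" where
  "letter_eval H f (Pos x) = f x"
| "letter_eval H f (Neg x) = inv\<^bsub>H\<^esub> (f x)"

primrec word_eval :: "('b, 'c) monoid_scheme \<Rightarrow> ('a \<Rightarrow> 'b) \<Rightarrow> 'a word \<Rightarrow> 'b" where
  "word_eval H f [] = \<one>\<^bsub>H\<^esub>"
| "word_eval H f (l # w) = letter_eval H f l \<otimes>\<^bsub>H\<^esub> word_eval H f w"

context group
begin

lemma letter_eval_closed: "range f \<subseteq> carrier G \<Longrightarrow> letter_eval G f l \<in> carrier G"
  by (cases l) auto

lemma word_eval_closed: "range f \<subseteq> carrier G \<Longrightarrow> word_eval G f w \<in> carrier G"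
  by (induction w) (auto simp: letter_eval_closed)

lemma word_eval_append:
  "range f \<subseteq> carrier G \<Longrightarrow> word_eval G f (u @ v) = word_eval G f u \<otimes> word_eval G f v"
  by (induction u) (auto simp: letter_eval_closed word_eval_closed m_assoc)

text \<open>Cancellations hold in every group, so by rule induction on the equivalence only the
  defining relations need to be checked.\<close>

lemma word_eval_cong:
  assumes f: "range f \<subseteq> carrier G"
    and rel: "\<And>r s. (r, s) \<in> R \<Longrightarrow> word_eval G f r = word_eval G f s"
    and "word_equiv R u v"
  shows "word_eval G f u = word_eval G f v"
  using assms(3)
proof (induction rule: word_equiv.induct)
  case (cancel_Pos_Neg u x v)
  have "f x \<in> carrier G" using f by auto
  then have "word_eval G f ([Pos x, Neg x] @ v) = word_eval G f v"
    using word_eval_closed[OF f, of v] by (simp flip: m_assoc)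
  then show ?case by (simp only: word_eval_append[OF f, of u])
next
  case (cancel_Neg_Pos u x v)
  have "f x \<in> carrier G" using f by auto
  then have "word_eval G f ([Neg x, Pos x] @ v) = word_eval G f v"
    using word_eval_closed[OF f, of v] by (simp flip: m_assoc)
  then show ?case by (simp only: word_eval_append[OF f, of u])
next
  case (relation r s u v)
  then show ?case by (simp add: word_eval_append[OF f] rel)
qed simp_all

text \<open>Von Dyck's theorem, the existence half of the universal property of a
  presentation.\<close>

lemma presented_group_hom_exists:
  assumes f: "range f \<subseteq> carrier G"
    and rel: "\<And>r s. (r, s) \<in> R \<Longrightarrow> word_eval G f r = word_eval G f s"
  obtains h where "h \<in> hom (presented_group R) G" "\<And>x. h (word_class R [Pos x]) = f x"
proof -
  \<comment> \<open>An arbitrary representative of the class is evaluated;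
    \<open>word_eval_cong\<close> makes the choice immaterial.\<close>
  define h where "h = (\<lambda>X. word_eval G f (SOME w. X = word_class R w))"
  have h: "h (word_class R w) = word_eval G f w" for w
  proof -
    have "word_class R w = word_class R (SOME v. word_class R w = word_class R v)"
      by (rule someI) simp
    then have "word_equiv R w (SOME v. word_class R w = word_class R v)"
      by (simp only: word_class_eq_iff)
    from word_eval_cong[OF f rel this] show ?thesis unfolding h_def by simp
  qed
  show thesis
  proof
    show "h \<in> hom (presented_group R) G"
      by (rule homI)
        (auto simp: carrier_presented_group presented_group_mult h word_eval_append[OF f]
          word_eval_closed[OF f])
    show "h (word_class R [Pos x]) = f x" for x
      using f by (simp add: h range_subsetD)
  qed
qed

text \<open>Here \<open>z\<close> is the conjugate of \<open>y\<close> by \<open>x\<close>, and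
  conjugation respects powers. This moves \<open>gen 2\<close> and \<open>gen 3\<close> past powers
  of the other generators.\<close>

lemma pow_shift_commute:
  fixes n :: int
  assumes "x \<in> carrier G" "y \<in> carrier G" "z \<in> carrier G" and xy: "x \<otimes> y = z \<otimes> x"
  shows "x \<otimes> y [^] n = z [^] n \<otimes> x"
proof -
  have z: "z = x \<otimes> y \<otimes> inv x" using assms by (simp add: xy m_assoc)
  have nat: "x \<otimes> y [^] k = z [^] k \<otimes> x" for k :: nat
  proof (induction k)
    case (Suc k)
    have "x \<otimes> y [^] Suc k = z [^] k \<otimes> (x \<otimes> y)"
      using assms(1-3) Suc by (simp flip: m_assoc)
    then show ?case using assms(1-3) by (simp add: xy m_assoc)
  qed (use assms in simp)
  show ?thesis
  proof (cases n)
    case (neg k)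
    have "x \<otimes> y [^] Suc k = z [^] Suc k \<otimes> x" by (rule nat)
    \<comment> \<open>Negative exponents come from the positive ones: multiply
      \<open>x a = b x\<close> by \<open>inv b\<close> on the left and by \<open>inv a\<close> on
      the right.\<close>
    moreover have "inv b \<otimes> x = x \<otimes> inv a"
      if ab: "x \<otimes> a = b \<otimes> x" "a \<in> carrier G" "b \<in> carrier G" for a b
    proof -
      have "inv b \<otimes> x = inv b \<otimes> (x \<otimes> a) \<otimes> inv a"
        using assms(1) that(2,3) by (simp add: m_assoc)
      also have "\<dots> = x \<otimes> inv a"
        using assms(1) that(2,3) unfolding ab(1) by (simp flip: m_assoc)
      finally show ?thesis .
    qed
    ultimately have "inv (z [^] Suc k) \<otimes> x = x \<otimes> inv (y [^] Suc k)"
      using assms(2,3) by blast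
    then show ?thesis
      using neg assms(2,3) by (simp add: int_pow_neg int_pow_int del: nat_pow_Suc of_nat_Suc)
  qed (simp add: nat int_pow_int)
qed

end

section \<open>Uniqueness of a homomorphism with given values on the generators\<close>

lemma word_class_Cons:
  "word_class R (l # w) = word_class R [l] \<otimes>\<^bsub>presented_group R\<^esub> word_class R w"
  by (simp add: presented_group_mult)

lemma word_class_Neg:
  "word_class R [Neg x] = inv\<^bsub>presented_group R\<^esub> (word_class R [Pos x])"
proof -
  interpret group "presented_group R" by (rule group_presented_group)
  have "word_class R [Neg x] \<otimes>\<^bsub>presented_group R\<^esub> word_class R [Pos x] = \<one>\<^bsub>presented_group R\<^esub>"
    using word_equiv_left_inverse[of R "[Pos x]"]
    by (simp add: presented_group_mult one_presented_group word_class_eq_iff)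
  then show ?thesis
    by (intro inv_equality[symmetric]) (auto simp: carrier_presented_group)
qed

lemma hom_presented_group_eval:
  assumes "group H" and h: "h \<in> hom (presented_group R) H"
  shows "h (word_class R w) = word_eval H (\<lambda>x. h (word_class R [Pos x])) w"
proof -
  interpret group_hom "presented_group R" H h
    using assms group_presented_group by (simp add: group_hom_def group_hom_axioms_def)
  have c: "word_class R v \<in> carrier (presented_group R)" for v
    by (simp add: carrier_presented_group)
  define f where "f = (\<lambda>x. h (word_class R [Pos x]))"
  have l: "h (word_class R [l]) = letter_eval H f l" for l
    by (cases l) (simp_all add: f_def word_class_Neg c)
  have "h (word_class R w) = word_eval H f w"
  proof (induction w)
    case (Cons l w)
    then show ?case by (simp add: word_class_Cons[of R l w] c l)
  qed (use hom_one in \<open>simp add: one_presented_group\<close>)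
  then show ?thesis by (simp add: f_def)
qed

lemma hom_presented_group_eqI:
  assumes "group H" "h \<in> hom (presented_group R) H" "k \<in> hom (presented_group R) H"
    and "\<And>x. h (word_class R [Pos x]) = k (word_class R [Pos x])"
    and "X \<in> carrier (presented_group R)"
  shows "h X = k X"
proof -
  obtain w where "X = word_class R w"
    using assms(5) by (auto simp: carrier_presented_group)
  then show ?thesis
    by (simp only: hom_presented_group_eval[OF assms(1,2), of w]
        hom_presented_group_eval[OF assms(1,3), of w] assms(4))
qed


section \<open>Coordinates on \<open>G\<^sub>3\<close>\<close>

text \<open>This is (-1)^n k, the action of an element with exponent sum \<open>n\<close> in
  \<open>gen 2\<close> and \<open>gen 3\<close> on the powers of \<open>gen 1\<close>.\<close>

definition signed :: "int \<Rightarrow> int \<Rightarrow> int" where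
  "signed n k = (if even n then k else - k)"

text \<open>A concrete model of the semidirect product: \<open>(a, b, c)\<close> plays the role of
  \<open>el a b c\<close>. Equality of triples is plain, which separates the normal forms in
  \<open>G3\<close>.\<close>

definition T3 :: "(int \<times> int \<times> int) monoid" where
  "T3 = \<lparr>carrier = UNIV,
     monoid.mult = (\<lambda>(a, b, c) (a', b', c'). (a + signed (b + c) a', b + b', c + c')),
     one = (0, 0, 0)\<rparr>"

lemma T3_simps:
  "carrier T3 = UNIV"
  "(a, b, c) \<otimes>\<^bsub>T3\<^esub> (a', b', c') = (a + signed (b + c) a', b + b', c + c')"
  "\<one>\<^bsub>T3\<^esub> = (0, 0, 0)"
  by (simp_all add: T3_def)

lemma group_T3: "group T3"
proof (rule groupI)
  fix x :: "int \<times> int \<times> int"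
  obtain a b c where "x = (a, b, c)" by (cases x)
  then have "(- signed (b + c) a, - b, - c) \<otimes>\<^bsub>T3\<^esub> x = \<one>\<^bsub>T3\<^esub>"
    by (auto simp: T3_simps signed_def)
  then show "\<exists>y\<in>carrier T3. y \<otimes>\<^bsub>T3\<^esub> x = \<one>\<^bsub>T3\<^esub>" by (auto simp: T3_simps)
qed (auto simp: T3_simps signed_def)

lemma T3_inv: "inv\<^bsub>T3\<^esub> (a, b, c) = (- signed (b + c) a, - b, - c)"
  by (rule group.inv_equality[OF group_T3]) (auto simp: T3_simps signed_def)

lemma T3_pow:
  fixes n :: int
  shows "(1, 0, 0) [^]\<^bsub>T3\<^esub> n = (n, 0, 0)" "(0, 1, 0) [^]\<^bsub>T3\<^esub> n = (0, n, 0)"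
    "(0, 0, 1) [^]\<^bsub>T3\<^esub> n = (0, 0, n)"
proof -
  interpret group T3 by (rule group_T3)
  have nat: "(1, 0, 0) [^]\<^bsub>T3\<^esub> k = (int k, 0, 0)" "(0, 1, 0) [^]\<^bsub>T3\<^esub> k = (0, int k, 0)"
    "(0, 0, 1) [^]\<^bsub>T3\<^esub> k = (0, 0, int k)" for k :: nat
    by (induction k) (auto simp: T3_simps signed_def)
  show "(1, 0, 0) [^]\<^bsub>T3\<^esub> n = (n, 0, 0)" "(0, 1, 0) [^]\<^bsub>T3\<^esub> n = (0, n, 0)"
    "(0, 0, 1) [^]\<^bsub>T3\<^esub> n = (0, 0, n)"
    by (auto simp: int_pow_def2 nat T3_inv signed_def)
qed

section \<open>Normal forms in \<open>G3\<close>: existence, uniqueness and multiplication\<close>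

interpretation G3: group G3
  unfolding G3_def by (rule group_presented_group)

definition el :: "int \<Rightarrow> int \<Rightarrow> int \<Rightarrow> 3 word set" where
  "el a b c = gen 1 [^]\<^bsub>G3\<^esub> a \<otimes>\<^bsub>G3\<^esub> gen 2 [^]\<^bsub>G3\<^esub> b \<otimes>\<^bsub>G3\<^esub> gen 3 [^]\<^bsub>G3\<^esub> c"

lemma gen_closed [simp]: "gen j \<in> carrier G3"
  by (simp add: gen_def G3_def carrier_presented_group)

lemma el_closed [simp]: "el a b c \<in> carrier G3"
  by (simp add: el_def)

lemma gen_el: "gen 1 = el 1 0 0" "gen 2 = el 0 1 0" "gen 3 = el 0 0 1"
  by (simp_all add: el_def)

lemma gen_relations:
  "gen 2 \<otimes>\<^bsub>G3\<^esub> gen 1 = inv\<^bsub>G3\<^esub> gen 1 \<otimes>\<^bsub>G3\<^esub> gen 2"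
  "gen 3 \<otimes>\<^bsub>G3\<^esub> gen 1 = inv\<^bsub>G3\<^esub> gen 1 \<otimes>\<^bsub>G3\<^esub> gen 3"
  "gen 3 \<otimes>\<^bsub>G3\<^esub> gen 2 = gen 2 \<otimes>\<^bsub>G3\<^esub> gen 3"
proof -
  have rel: "word_class G3_rels r = word_class G3_rels s" if "(r, s) \<in> G3_rels" for r s
    using word_equiv.relation[OF that, of "[]" "[]"] by (simp add: word_class_eq_iff)
  show "gen 2 \<otimes>\<^bsub>G3\<^esub> gen 1 = inv\<^bsub>G3\<^esub> gen 1 \<otimes>\<^bsub>G3\<^esub> gen 2"
    "gen 3 \<otimes>\<^bsub>G3\<^esub> gen 1 = inv\<^bsub>G3\<^esub> gen 1 \<otimes>\<^bsub>G3\<^esub> gen 3"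
    "gen 3 \<otimes>\<^bsub>G3\<^esub> gen 2 = gen 2 \<otimes>\<^bsub>G3\<^esub> gen 3"
    unfolding gen_def G3_def word_class_Neg[symmetric] presented_group_mult
    by (rule rel, simp add: G3_rels_def)+
qed

lemma gen1_el: "gen 1 [^]\<^bsub>G3\<^esub> (k :: int) \<otimes>\<^bsub>G3\<^esub> el a b c = el (k + a) b c"
  by (simp add: el_def G3.int_pow_mult G3.m_assoc)

lemma gen2_el: "gen 2 \<otimes>\<^bsub>G3\<^esub> el a b c = el (- a) (1 + b) c"
proof -
  have "gen 2 \<otimes>\<^bsub>G3\<^esub> gen 1 [^]\<^bsub>G3\<^esub> a = gen 1 [^]\<^bsub>G3\<^esub> - a \<otimes>\<^bsub>G3\<^esub> gen 2"
    using G3.pow_shift_commute[OF _ _ _ gen_relations(1), of a]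
    by (simp add: G3.int_pow_neg G3.int_pow_inv)
  then have "gen 2 \<otimes>\<^bsub>G3\<^esub> el a b c =
      gen 1 [^]\<^bsub>G3\<^esub> - a \<otimes>\<^bsub>G3\<^esub> (gen 2 \<otimes>\<^bsub>G3\<^esub> gen 2 [^]\<^bsub>G3\<^esub> b) \<otimes>\<^bsub>G3\<^esub> gen 3 [^]\<^bsub>G3\<^esub> c"
    by (simp add: el_def flip: G3.m_assoc)
  then show ?thesis by (simp add: el_def G3.int_pow_mult)
qed

lemma gen3_el: "gen 3 \<otimes>\<^bsub>G3\<^esub> el a b c = el (- a) b (1 + c)"
proof -
  have 1: "gen 3 \<otimes>\<^bsub>G3\<^esub> gen 1 [^]\<^bsub>G3\<^esub> a = gen 1 [^]\<^bsub>G3\<^esub> - a \<otimes>\<^bsub>G3\<^esub> gen 3"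
    using G3.pow_shift_commute[OF _ _ _ gen_relations(2), of a]
    by (simp add: G3.int_pow_neg G3.int_pow_inv)
  have 2: "gen 3 \<otimes>\<^bsub>G3\<^esub> gen 2 [^]\<^bsub>G3\<^esub> b = gen 2 [^]\<^bsub>G3\<^esub> b \<otimes>\<^bsub>G3\<^esub> gen 3"
    using G3.pow_shift_commute[OF _ _ _ gen_relations(3), of b] by simp
  have "gen 3 \<otimes>\<^bsub>G3\<^esub> el a b c =
      (gen 3 \<otimes>\<^bsub>G3\<^esub> gen 1 [^]\<^bsub>G3\<^esub> a) \<otimes>\<^bsub>G3\<^esub> gen 2 [^]\<^bsub>G3\<^esub> b \<otimes>\<^bsub>G3\<^esub> gen 3 [^]\<^bsub>G3\<^esub> c"
    by (simp add: el_def G3.m_assoc)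
  also have "\<dots> = gen 1 [^]\<^bsub>G3\<^esub> - a \<otimes>\<^bsub>G3\<^esub> (gen 3 \<otimes>\<^bsub>G3\<^esub> gen 2 [^]\<^bsub>G3\<^esub> b) \<otimes>\<^bsub>G3\<^esub> gen 3 [^]\<^bsub>G3\<^esub> c"
    by (simp only: 1) (simp add: G3.m_assoc)
  also have "\<dots> = gen 1 [^]\<^bsub>G3\<^esub> - a \<otimes>\<^bsub>G3\<^esub> gen 2 [^]\<^bsub>G3\<^esub> b \<otimes>\<^bsub>G3\<^esub> (gen 3 \<otimes>\<^bsub>G3\<^esub> gen 3 [^]\<^bsub>G3\<^esub> c)"
    by (simp only: 2) (simp add: G3.m_assoc)
  finally show ?thesis by (simp add: el_def G3.int_pow_mult)
qed

text \<open>The normal forms contain the identity and are stable under left multiplication by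
  generators and their inverses, so induction on words reaches every element.\<close>

lemma carrier_G3_el: "x \<in> carrier G3 \<longleftrightarrow> (\<exists>a b c. x = el a b c)"
proof
  have inv_el: "inv\<^bsub>G3\<^esub> g \<otimes>\<^bsub>G3\<^esub> el a b c = el a' b' c'"
    if "g \<in> carrier G3" "g \<otimes>\<^bsub>G3\<^esub> el a' b' c' = el a b c" for g a b c a' b' c'
    using that by (metis G3.inv_solve_left el_closed)
  have "\<exists>a b c. word_class G3_rels w = el a b c" for w
  proof (induction w)
    case Nil
    have "word_class G3_rels [] = el 0 0 0"
      by (simp add: el_def flip: one_presented_group) (simp add: G3_def)
    then show ?case by blast
  next
    case (Cons l w)
    then obtain a b c where w: "word_class G3_rels w = el a b c" by blast
    have "\<exists>a' b' c'. gen j \<otimes>\<^bsub>G3\<^esub> el a b c = el a' b' c'" for j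
      using exhaust_3[of j] gen1_el[of 1] gen2_el gen3_el by auto blast+
    moreover have "\<exists>a' b' c'. inv\<^bsub>G3\<^esub> gen j \<otimes>\<^bsub>G3\<^esub> el a b c = el a' b' c'" for j
    proof -
      \<comment> \<open>For inverse letters it is enough that left multiplication by a generator
        hits every normal form; the preimages are read off from the three formulas.\<close>
      have "\<exists>a' b' c'. gen j \<otimes>\<^bsub>G3\<^esub> el a' b' c' = el a b c"
        using exhaust_3[of j] gen1_el[of 1 "a - 1" b c] gen2_el[of "- a" "b - 1" c]
          gen3_el[of "- a" b "c - 1"] by auto
      then show ?thesis using inv_el[OF gen_closed] by blast
    qed
    moreover have "word_class G3_rels (l # w) = word_class G3_rels [l] \<otimes>\<^bsub>G3\<^esub> el a b c"
      by (simp only: word_class_Cons[of _ l w] w G3_def)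
    ultimately show ?case
      by (cases l) (simp_all add: word_class_Neg gen_def G3_def)
  qed
  then show "x \<in> carrier G3 \<Longrightarrow> \<exists>a b c. x = el a b c"
    by (auto simp: G3_def carrier_presented_group)
qed auto

text \<open>The standard triples satisfy the three relations in \<open>T3\<close>, so the universal
  property yields a homomorphism; it reads off the exponents of a normal form.\<close>

lemma coordinates_exist:
  obtains h where "h \<in> hom G3 T3" "\<And>a b c. h (el a b c) = (a, b, c)"
proof -
  define f :: "3 \<Rightarrow> int \<times> int \<times> int" where
    "f j = (if j = 1 then (1, 0, 0) else if j = 2 then (0, 1, 0) else (0, 0, 1))" for j
  interpret T3: group T3 by (rule group_T3)
  obtain h where h: "h \<in> hom G3 T3" and hf: "\<And>j. h (gen j) = f j"
  proof (rule T3.presented_group_hom_exists[of f G3_rels])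
    show "word_eval T3 f r = word_eval T3 f s" if "(r, s) \<in> G3_rels" for r s
      using that by (auto simp: G3_rels_def f_def T3_simps T3_inv signed_def)
  qed (auto simp: T3_simps G3_def gen_def)
  interpret h: group_hom G3 T3 h
    using h group_T3 by (simp add: group_hom_def group_hom_axioms_def G3.group_axioms)
  have "h (el a b c) = (a, b, c)" for a b c
    by (simp add: el_def h.hom_int_pow hf f_def T3_pow) (simp add: T3_simps signed_def)
  with h that show thesis by blast
qed

lemma el_eq_iff [simp]: "el a b c = el a' b' c' \<longleftrightarrow> a = a' \<and> b = b' \<and> c = c'"
  by (metis coordinates_exist prod.inject)

text \<open>The product has some normal form, and its exponents are computed in \<open>T3\<close>
  rather than by rewriting with the relations.\<close>

lemma el_mult [simp]:
  "el a b c \<otimes>\<^bsub>G3\<^esub> el a' b' c' = el (a + signed (b + c) a') (b + b') (c + c')"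
proof -
  obtain h where h: "h \<in> hom G3 T3" and el: "\<And>a b c. h (el a b c) = (a, b, c)"
    using coordinates_exist by blast
  obtain x y z where xyz: "el a b c \<otimes>\<^bsub>G3\<^esub> el a' b' c' = el x y z"
    using carrier_G3_el G3.m_closed el_closed by metis
  have "h (el a b c \<otimes>\<^bsub>G3\<^esub> el a' b' c') = (a, b, c) \<otimes>\<^bsub>T3\<^esub> (a', b', c')"
    using h by (simp add: hom_mult el)
  then show ?thesis by (simp add: xyz el T3_simps)
qed

lemma one_el: "\<one>\<^bsub>G3\<^esub> = el 0 0 0"
  by (simp add: el_def)

lemma hom_G3_eqI:
  assumes "h \<in> hom G3 G3" "k \<in> hom G3 G3"
    and "h (gen 1) = k (gen 1)" "h (gen 2) = k (gen 2)" "h (gen 3) = k (gen 3)"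
    and "x \<in> carrier G3"
  shows "h x = k x"
proof (rule hom_presented_group_eqI[OF G3.group_axioms, of h G3_rels k])
  show "h (word_class G3_rels [Pos j]) = k (word_class G3_rels [Pos j])" for j
    using assms(3-5) exhaust_3[of j] unfolding gen_def by metis
qed (use assms in \<open>simp_all add: G3_def\<close>)


section \<open>Automorphisms in coordinates\<close>

definition coord :: "3 word set \<Rightarrow> int \<times> int \<times> int" where
  "coord = inv_into UNIV (\<lambda>(a, b, c). el a b c)"

lemma coord_el [simp]: "coord (el a b c) = (a, b, c)"
proof -
  have "inj (\<lambda>(a, b, c). el a b c)" by (auto simp: inj_def)
  from inv_f_f[OF this, of "(a, b, c)"] show ?thesis by (simp add: coord_def)
qed

text \<open>The alternating sum a - a + a - ... with \<open>n\<close> terms for \<open>n\<close>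
  nonnegative. As a function of \<open>(b, c)\<close>, \<open>odd_part (b + c) a\<close> is the
  crossed homomorphism with value \<open>a\<close> on both basis vectors, as
  \<open>odd_part_add\<close> states.\<close>

definition odd_part :: "int \<Rightarrow> int \<Rightarrow> int" where
  "odd_part n a = (if odd n then a else 0)"

lemma odd_part_simps [simp]: "odd_part 0 a = 0" "odd_part 1 a = a" "odd_part n 0 = 0"
  by (simp_all add: odd_part_def)

lemma signed_linear:
  "signed n (x + y) = signed n x + signed n y" "signed n (e * x) = e * signed n x"
  by (simp_all add: signed_def)

lemma odd_part_add:
  "odd_part (b + b' + (c + c')) a = odd_part (b + c) a + signed (b + c) (odd_part (b' + c') a)"
  by (auto simp: odd_part_def signed_def)

text \<open>The map \<open>(e, a, M)\<close>, given on all normal forms and not only on generators.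
  The restriction to the carrier matches the extensional functions in \<open>auto\<close>.\<close>

definition twist :: "int \<Rightarrow> int \<Rightarrow> int^2^2 \<Rightarrow> 3 word set \<Rightarrow> 3 word set" where
  "twist e a M = (\<lambda>x\<in>carrier G3. case coord x of (k, b, c) \<Rightarrow>
     el (e * k + odd_part (b + c) a)
       (M $ 1 $ 1 * b + M $ 1 $ 2 * c) (M $ 2 $ 1 * b + M $ 2 $ 2 * c))"

definition odd_cols :: "int^2^2 \<Rightarrow> bool" where
  "odd_cols M \<longleftrightarrow> odd (M $ 1 $ 1 + M $ 2 $ 1) \<and> odd (M $ 1 $ 2 + M $ 2 $ 2)"

lemma twist_el [simp]:
  "twist e a M (el k b c) = el (e * k + odd_part (b + c) a)
     (M $ 1 $ 1 * b + M $ 1 $ 2 * c) (M $ 2 $ 1 * b + M $ 2 $ 2 * c)"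
  by (simp add: twist_def)

lemma twist_extensional [simp]: "twist e a M \<in> extensional (carrier G3)"
  by (simp add: twist_def)

text \<open>Modulo 2 the row vector (1, 1) is fixed by \<open>M\<close>, so \<open>M\<close>
  preserves the parity of the exponent sum, and with it the action on \<open>gen 1\<close>.\<close>

lemma odd_cols_parity:
  assumes "odd_cols M"
  defines "n b c \<equiv> M $ 1 $ 1 * b + M $ 1 $ 2 * c + (M $ 2 $ 1 * b + M $ 2 $ 2 * c)"
  shows "signed (n b c) k = signed (b + c) k" "odd_part (n b c) k = odd_part (b + c) k"
proof -
  have "even (n b c) \<longleftrightarrow> even (b + c)"
    using assms by (auto simp: odd_cols_def)
  then show "signed (n b c) k = signed (b + c) k" "odd_part (n b c) k = odd_part (b + c) k"
    by (simp_all only: signed_def odd_part_def)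
qed

lemma twist_hom:
  assumes "odd_cols M"
  shows "twist e a M \<in> hom G3 G3"
proof (rule homI)
  fix x y assume "x \<in> carrier G3" "y \<in> carrier G3"
  then obtain k b c k' b' c' where "x = el k b c" "y = el k' b' c'"
    by (auto simp: carrier_G3_el)
  then show "twist e a M (x \<otimes>\<^bsub>G3\<^esub> y) = twist e a M x \<otimes>\<^bsub>G3\<^esub> twist e a M y"
    by (simp add: odd_cols_parity[OF assms] signed_linear odd_part_add distrib_left)
qed (auto simp: carrier_G3_el)

section \<open>Composition and inversion of twists\<close>

lemma matrix_mult_2:
  fixes M N :: "int^2^2"
  shows "(M ** N) $ i $ j = M $ i $ 1 * N $ 1 $ j + M $ i $ 2 * N $ 2 $ j"
  by (simp add: matrix_matrix_mult_def sum_2)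

lemma matrix_eq_iff_2:
  fixes M N :: "int^2^2"
  shows "M = N \<longleftrightarrow> M $ 1 $ 1 = N $ 1 $ 1 \<and> M $ 1 $ 2 = N $ 1 $ 2 \<and>
    M $ 2 $ 1 = N $ 2 $ 1 \<and> M $ 2 $ 2 = N $ 2 $ 2"
  by (auto simp: vec_eq_iff forall_2)

lemma mat_1_2:
  "(mat 1 :: int^2^2) $ 1 $ 1 = 1" "(mat 1 :: int^2^2) $ 1 $ 2 = 0"
  "(mat 1 :: int^2^2) $ 2 $ 1 = 0" "(mat 1 :: int^2^2) $ 2 $ 2 = 1"
  by (simp_all add: mat_def)

lemma odd_cols_one: "odd_cols (mat 1)"
  by (simp add: odd_cols_def mat_1_2)

lemma odd_cols_mult: "odd_cols M \<Longrightarrow> odd_cols N \<Longrightarrow> odd_cols (M ** N)"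
  unfolding odd_cols_def matrix_mult_2 by auto

text \<open>Modulo 2, (1, 1) N = (1, 1) M N = (1, 1).\<close>

lemma odd_cols_right_inverse:
  assumes "odd_cols M" "M ** N = mat 1"
  shows "odd_cols N"
  using odd_cols_one assms(1) unfolding assms(2)[symmetric] odd_cols_def matrix_mult_2 by auto

text \<open>Since \<open>N\<close> preserves parity, both \<open>odd_part\<close> terms switch on
  for the same arguments and add up to one with value \<open>a + e * b\<close>.\<close>

lemma twist_compose:
  assumes "odd_cols N"
  shows "compose (carrier G3) (twist e a M) (twist f b N) = twist (e * f) (a + e * b) (M ** N)"
proof (rule extensionalityI)
  fix x assume "x \<in> carrier G3"
  then obtain k u v where "x = el k u v" by (auto simp: carrier_G3_el)
  then show "compose (carrier G3) (twist e a M) (twist f b N) x = twist (e * f) (a + e * b) (M ** N) x"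
    by (simp add: compose_def odd_cols_parity[OF assms])
      (simp add: matrix_mult_2 signed_linear odd_part_def algebra_simps)
qed (simp_all add: compose_def)

lemma twist_one: "x \<in> carrier G3 \<Longrightarrow> twist 1 0 (mat 1) x = x"
  by (auto simp: carrier_G3_el mat_1_2)

text \<open>The composition law dictates the middle entry: \<open>a + e * b = 0\<close> has the
  solution \<open>b = - e * a\<close> because \<open>e * e = 1\<close>.\<close>

lemma twist_inverse:
  assumes "e * e = 1" "odd_cols N" "M ** N = mat 1" "x \<in> carrier G3"
  shows "twist e a M (twist e (- e * a) N x) = x"
proof -
  have e: "e * (e * a) = a" using assms(1) by (simp flip: mult.assoc)
  have "compose (carrier G3) (twist e a M) (twist e (- e * a) N) x = x"
    using assms by (simp add: twist_compose twist_one e)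
  then show ?thesis using assms(4) by (simp add: compose_eq)
qed

lemma twist_auto:
  assumes e: "e * e = 1" and M: "odd_cols M" "invertible M"
  shows "twist e a M \<in> auto G3"
proof -
  obtain N where N: "M ** N = mat 1" "N ** M = mat 1"
    using M(2) by (auto simp: invertible_def)
  have oN: "odd_cols N" using odd_cols_right_inverse[OF M(1) N(1)] .
  define b where "b = - e * a"
  \<comment> \<open>Thus \<open>twist_inverse\<close> also applies with the two maps exchanged,
    which gives the inverse on the other side.\<close>
  have b: "- e * b = a" using e by (simp add: b_def flip: mult.assoc)
  have inv1: "twist e b N (twist e a M x) = x"
    and inv2: "twist e a M (twist e b N x) = x" if "x \<in> carrier G3" for x
    using twist_inverse[OF e M(1) N(2) that, of b] twist_inverse[OF e oN N(1) that, of a]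
    by (simp_all only: b b_def[symmetric])
  have closed: "twist e' a' M' x \<in> carrier G3" if "x \<in> carrier G3" for e' a' M' x
    using that by (auto simp: carrier_G3_el)
  have "bij_betw (twist e a M) (carrier G3) (carrier G3)"
    by (rule bij_betwI[where g = "twist e b N"]) (auto simp: closed inv1 inv2)
  then show ?thesis by (simp add: auto_def Bij_def twist_hom[OF M(1)])
qed

section \<open>Every automorphism is a twist\<close>

lemma injective_hom_is_twist:
  assumes h: "h \<in> hom G3 G3" and inj: "inj_on h (carrier G3)" and ext: "h \<in> extensional (carrier G3)"
  obtains e a M where "odd_cols M" "h = twist e a M"
proof -
  have closed: "h x \<in> carrier G3" if "x \<in> carrier G3" for x
    using h that by (rule hom_in_carrier)
  obtain e q r where h1: "h (el 1 0 0) = el e q r" using closed[of "el 1 0 0"] by (auto simp: carrier_G3_el)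
  obtain a u v where h2: "h (el 0 1 0) = el a u v" using closed[of "el 0 1 0"] by (auto simp: carrier_G3_el)
  obtain b w z where h3: "h (el 0 0 1) = el b w z" using closed[of "el 0 0 1"] by (auto simp: carrier_G3_el)
  have mult: "h (x \<otimes>\<^bsub>G3\<^esub> y) = h x \<otimes>\<^bsub>G3\<^esub> h y" if "x \<in> carrier G3" "y \<in> carrier G3" for x y
    using h that by (rule hom_mult)
  \<comment> \<open>The defining relations in a form without inverses, so that their images under
    \<open>h\<close> can be compared exponent by exponent.\<close>
  have rel: "el 1 0 0 \<otimes>\<^bsub>G3\<^esub> (el 0 1 0 \<otimes>\<^bsub>G3\<^esub> el 1 0 0) = el 0 1 0"
    "el 1 0 0 \<otimes>\<^bsub>G3\<^esub> (el 0 0 1 \<otimes>\<^bsub>G3\<^esub> el 1 0 0) = el 0 0 1"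
    "el 0 0 1 \<otimes>\<^bsub>G3\<^esub> el 0 1 0 = el 0 1 0 \<otimes>\<^bsub>G3\<^esub> el 0 0 1"
    by (simp_all add: signed_def)
  have hrel: "el e q r \<otimes>\<^bsub>G3\<^esub> (el a u v \<otimes>\<^bsub>G3\<^esub> el e q r) = el a u v"
    "el e q r \<otimes>\<^bsub>G3\<^esub> (el b w z \<otimes>\<^bsub>G3\<^esub> el e q r) = el b w z"
    "el b w z \<otimes>\<^bsub>G3\<^esub> el a u v = el a u v \<otimes>\<^bsub>G3\<^esub> el b w z"
    using rel[THEN arg_cong, of h] by (simp_all only: mult G3.m_closed el_closed h1 h2 h3)
  \<comment> \<open>The last two exponents of the first equation say \<open>2 * q = 0\<close> and
    \<open>2 * r = 0\<close>.\<close>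
  have qr: "q = 0" "r = 0" using hrel(1) by simp_all
  have "h (el 1 0 0) \<noteq> h (el 0 0 0)" using inj_onD[OF inj, of "el 1 0 0" "el 0 0 0"] by auto
  moreover have "h (el 0 0 0) = el 0 0 0"
    using hom_one[OF h G3.group_axioms G3.group_axioms] by (simp add: one_el)
  ultimately have e: "e \<noteq> 0" by (simp add: h1 qr)
  \<comment> \<open>The first exponents now say \<open>signed (u + v) e = - e\<close> and
    \<open>signed (w + z) e = - e\<close>, which for nonzero \<open>e\<close> forces odd
    sums.\<close>
  have odd: "odd (u + v)" "odd (w + z)"
    using hrel(1,2) e by (auto simp: qr signed_def split: if_splits)
  \<comment> \<open>With both signs negative the commutation relation becomes
    \<open>b - a = a - b\<close>.\<close>
  have ab: "a = b" using hrel(3) odd by (simp add: signed_def)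
  define M :: "int^2^2" where "M = vector [vector [u, w], vector [v, z]]"
  have M: "odd_cols M" using odd by (simp add: M_def odd_cols_def)
  have "h = twist e a M"
  proof (rule extensionalityI)
    fix x assume "x \<in> carrier G3"
    then show "h x = twist e a M x"
      by (rule hom_G3_eqI[OF h twist_hom[OF M], rotated 3]) (simp_all add: gen_el h1 h2 h3 qr ab M_def)
  qed (use ext in auto)
  with M that show thesis by blast
qed

text \<open>The inverse of an automorphism is a twist too. Comparing the two composites with the
  identity on generators shows that \<open>e\<close> is a unit and that \<open>M\<close> is
  invertible.\<close>

lemma auto_G3: "auto G3 = {twist e a M | e a M. e \<in> {1, - 1} \<and> odd_cols M \<and> invertible M}"
proof (intro equalityI subsetI)
  fix h assume h: "h \<in> auto G3"
  then have hom: "h \<in> hom G3 G3" and ext: "h \<in> extensional (carrier G3)"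
    and bij: "bij_betw h (carrier G3) (carrier G3)"
    by (auto simp: auto_def Bij_def)
  define k where "k = (\<lambda>x\<in>carrier G3. inv_into (carrier G3) h x)"
  have "k \<in> auto G3"
    using h unfolding k_def auto_def
    by (auto intro: G3.restrict_inv_into_hom restrict_inv_into_Bij simp del: restrict_apply)
  then have khom: "k \<in> hom G3 G3" and kext: "k \<in> extensional (carrier G3)"
    and kbij: "bij_betw k (carrier G3) (carrier G3)"
    by (auto simp: auto_def Bij_def)
  obtain e a M where M: "odd_cols M" and hM: "h = twist e a M"
    using injective_hom_is_twist[OF hom bij_betw_imp_inj_on[OF bij] ext] .
  obtain f b N where N: "odd_cols N" and kN: "k = twist f b N"
    using injective_hom_is_twist[OF khom bij_betw_imp_inj_on[OF kbij] kext] .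
  have hk: "h (k x) = x" if "x \<in> carrier G3" for x
    using that bij unfolding k_def by (simp add: bij_betw_inv_into_right)
  have kh: "k (h x) = x" if "x \<in> carrier G3" for x
    using that bij unfolding k_def by (simp add: bij_betw_inv_into_left bij_betwE)
  have "e * f = 1" using hk[of "el 1 0 0"] by (simp add: hM kN)
  then have "e \<in> {1, - 1}" by (auto simp: zmult_eq_1_iff)
  moreover have "M ** N = mat 1"
    using hk[of "el 0 1 0"] hk[of "el 0 0 1"]
    by (simp add: hM kN matrix_eq_iff_2 matrix_mult_2 mat_1_2)
  moreover have "N ** M = mat 1"
    using kh[of "el 0 1 0"] kh[of "el 0 0 1"]
    by (simp add: hM kN matrix_eq_iff_2 matrix_mult_2 mat_1_2)
  ultimately show "h \<in> {twist e a M | e a M. e \<in> {1, - 1} \<and> odd_cols M \<and> invertible M}"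
    using M hM unfolding invertible_def by blast
qed (auto intro: twist_auto)

section \<open>From matrices to twists, and the inner automorphisms\<close>

lemma endo_eqI:
  assumes "\<phi> \<in> hom G3 G3" "\<phi> \<in> extensional (carrier G3)"
    and "\<phi> (gen 1) = el (C $ 1 $ 1) (C $ 2 $ 1) (C $ 3 $ 1)"
    and "\<phi> (gen 2) = el (C $ 1 $ 2) (C $ 2 $ 2) (C $ 3 $ 2)"
    and "\<phi> (gen 3) = el (C $ 1 $ 3) (C $ 2 $ 3) (C $ 3 $ 3)"
  shows "endo C = \<phi>"
  unfolding endo_def el_def[symmetric]
proof (rule the_equality)
  show "\<phi> \<in> hom G3 G3 \<inter> extensional (carrier G3) \<and>
      (\<forall>j. \<phi> (gen j) = el (C $ 1 $ j) (C $ 2 $ j) (C $ 3 $ j))"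
    using assms by (simp add: forall_3)
next
  fix \<psi>
  assume "\<psi> \<in> hom G3 G3 \<inter> extensional (carrier G3) \<and>
      (\<forall>j. \<psi> (gen j) = el (C $ 1 $ j) (C $ 2 $ j) (C $ 3 $ j))"
  then have \<psi>: "\<psi> \<in> hom G3 G3" "\<psi> \<in> extensional (carrier G3)"
    and gen: "\<psi> (gen j) = el (C $ 1 $ j) (C $ 2 $ j) (C $ 3 $ j)" for j
    by auto
  show "\<psi> = \<phi>"
  proof (rule extensionalityI[OF \<psi>(2) assms(2)])
    show "\<psi> x = \<phi> x" if "x \<in> carrier G3" for x
      using that by (rule hom_G3_eqI[OF \<psi>(1) assms(1), rotated 3]) (simp_all only: gen assms(3-5))
  qed
qed

lemma \<alpha>_eq_twist: "odd_cols M \<Longrightarrow> \<alpha> a M = twist 1 a M"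
  unfolding \<alpha>_def alpha_mat_def by (rule endo_eqI) (simp_all add: twist_hom gen_el)

lemma \<beta>_eq_twist: "odd_cols M \<Longrightarrow> \<beta> a M = twist (- 1) a M"
  unfolding \<beta>_def beta_mat_def by (rule endo_eqI) (simp_all add: twist_hom gen_el)

text \<open>Modulo 2, odd column sums leave one odd entry in each column, and an odd determinant
  keeps these two entries in different rows. What remains is the swap (\<open>matsA\<close>) or the
  identity (\<open>matsB\<close>).\<close>

lemma matsA_Un_matsB: "matsA \<union> matsB = {M. odd_cols M \<and> invertible M}"
proof (intro equalityI subsetI)
  fix M :: "int^2^2"
  assume "M \<in> {M. odd_cols M \<and> invertible M}"
  then have M: "odd_cols M" "invertible M" by auto
  then obtain N where "M ** N = mat 1" by (auto simp: invertible_def)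
  then have "det M * det N = 1" by (metis det_mul det_I)
  then have "odd (det M)" by (metis even_mult_iff odd_one)
  then have "odd (M $ 1 $ 1 * M $ 2 $ 2 - M $ 1 $ 2 * M $ 2 $ 1)" by (simp add: det_2)
  with M(1) have "even (M $ 1 $ 1) \<and> odd (M $ 1 $ 2) \<and> odd (M $ 2 $ 1) \<and> even (M $ 2 $ 2) \<or>
      odd (M $ 1 $ 1) \<and> even (M $ 1 $ 2) \<and> even (M $ 2 $ 1) \<and> odd (M $ 2 $ 2)"
    by (auto simp: odd_cols_def)
  then show "M \<in> matsA \<union> matsB"
    using M(2) unfolding matsA_def matsB_def
    by (auto simp: matrix_eq_iff_2 elim!: evenE oddE)
qed (auto simp: matsA_def matsB_def odd_cols_def)

lemma Inn_G3: "Inn G3 = {twist e (2 * a) (mat 1) | e a. e \<in> {1, - 1}}"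
proof -
  have conj: "(\<lambda>x\<in>carrier G3. el k b c \<otimes>\<^bsub>G3\<^esub> x \<otimes>\<^bsub>G3\<^esub> inv\<^bsub>G3\<^esub> el k b c) =
      twist (signed (b + c) 1) (2 * k) (mat 1)" for k b c
  proof (rule extensionalityI)
    fix x assume "x \<in> carrier G3"
    then obtain k' b' c' where x: "x = el k' b' c'" by (auto simp: carrier_G3_el)
    let ?t = "twist (signed (b + c) 1) (2 * k) (mat 1) x"
    have t: "?t \<in> carrier G3" by (simp add: x)
    \<comment> \<open>Cross-multiplying avoids the coordinates of the inverse. When
      \<open>b' + c'\<close> is odd, \<open>2 * k\<close> from the twist and \<open>- k\<close> from
      moving \<open>el k b c\<close> past it leave \<open>k\<close>; when it is even,
      \<open>k\<close> appears directly.\<close>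
    have "el k b c \<otimes>\<^bsub>G3\<^esub> x = ?t \<otimes>\<^bsub>G3\<^esub> el k b c"
      by (simp add: x mat_1_2 signed_def odd_part_def)
    then have "el k b c \<otimes>\<^bsub>G3\<^esub> x \<otimes>\<^bsub>G3\<^esub> inv\<^bsub>G3\<^esub> el k b c = ?t"
      using t by (simp only: G3.m_assoc el_closed G3.inv_closed G3.r_inv G3.r_one)
    then show "(\<lambda>x\<in>carrier G3. el k b c \<otimes>\<^bsub>G3\<^esub> x \<otimes>\<^bsub>G3\<^esub> inv\<^bsub>G3\<^esub> el k b c) x = ?t"
      using x by simp
  qed auto
  have sign: "signed n 1 \<in> {1, - 1}" for n
    by (simp add: signed_def)
  have "Inn G3 = {twist (signed (b + c) 1) (2 * k) (mat 1) | k b c. True}"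
    unfolding Inn_def by (auto simp: carrier_G3_el conj; metis conj)
  also have "\<dots> = {twist e (2 * a) (mat 1) | e a. e \<in> {1, - 1}}"
  proof (intro equalityI subsetI)
    fix h assume "h \<in> {twist e (2 * a) (mat 1) | e a. e \<in> {1, - 1}}"
    \<comment> \<open>The witnesses are conjugation by \<open>el a 0 0\<close> for sign 1 and by
      \<open>el a 1 0\<close> for sign -1; the sums are left unevaluated to match the pattern
      \<open>b + c\<close>.\<close>
    then obtain e a where "h = twist e (2 * a) (mat 1)" "e = signed (0 + 0) 1 \<or> e = signed (1 + 0) 1"
      by (auto simp: signed_def)
    then show "h \<in> {twist (signed (b + c) 1) (2 * k) (mat 1) | k b c. True}" by blast
  qed (use sign in blast)
  finally show ?thesis .
qed


section \<open>Outer automorphisms\<close>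

lemma carrier_AutoGroup: "carrier (AutoGroup G) = auto G"
  by (simp add: AutoGroup_def)

lemma AutoGroup_mult:
  assumes "g \<in> auto G" "h \<in> auto G"
  shows "g \<otimes>\<^bsub>AutoGroup G\<^esub> h = compose (carrier G) g h"
  using assms by (simp add: AutoGroup_def BijGroup_def auto_def)

section \<open>Inner automorphisms and their cosets in an arbitrary group\<close>

definition conj_by :: "('a, 'b) monoid_scheme \<Rightarrow> 'a \<Rightarrow> 'a \<Rightarrow> 'a" where
  "conj_by G g = (\<lambda>x\<in>carrier G. g \<otimes>\<^bsub>G\<^esub> x \<otimes>\<^bsub>G\<^esub> inv\<^bsub>G\<^esub> g)"

context group
begin

lemma conj_by_mult:
  assumes "g \<in> carrier G" "h \<in> carrier G"
  shows "conj_by G (g \<otimes> h) = compose (carrier G) (conj_by G g) (conj_by G h)"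
  using assms by (auto simp: conj_by_def compose_def m_assoc inv_mult_group)

lemma conj_by_inverse:
  assumes "g \<in> carrier G" "x \<in> carrier G"
  shows "conj_by G (inv g) (conj_by G g x) = x" "conj_by G g (conj_by G (inv g) x) = x"
  using assms by (simp_all add: conj_by_def flip: m_assoc) (simp_all add: m_assoc)

lemma conj_by_auto:
  assumes g: "g \<in> carrier G"
  shows "conj_by G g \<in> auto G"
proof -
  have "conj_by G g \<in> hom G G"
  proof (rule homI)
    fix x y assume xy: "x \<in> carrier G" "y \<in> carrier G"
    have "inv g \<otimes> (g \<otimes> (y \<otimes> inv g)) = y \<otimes> inv g"
      using g xy by (simp flip: m_assoc)
    then show "conj_by G g (x \<otimes> y) = conj_by G g x \<otimes> conj_by G g y"
      using g xy by (simp add: conj_by_def m_assoc)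
  qed (use g in \<open>simp add: conj_by_def\<close>)
  moreover have "bij_betw (conj_by G g) (carrier G) (carrier G)"
    by (rule bij_betwI[where g = "conj_by G (inv g)"])
      (use g conj_by_inverse[OF g] in \<open>auto simp: conj_by_def\<close>)
  ultimately show ?thesis
    by (simp add: auto_def Bij_def) (simp add: conj_by_def)
qed

lemma Inn_eq_image: "Inn G = conj_by G ` carrier G"
  by (auto simp: Inn_def conj_by_def)

text \<open>\<open>Inn G\<close> is the image of the homomorphism \<open>conj_by G\<close>, hence a
  subgroup. An automorphism \<open>h\<close> carries conjugation by \<open>g\<close> to conjugation
  by \<open>h g\<close>, hence normality.\<close>

lemma Inn_normal: "Inn G \<lhd> AutoGroup G"
proof -
  interpret A: group "AutoGroup G" by (rule AutoGroup)
  interpret c: group_hom G "AutoGroup G" "conj_by G"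
    by unfold_locales
      (auto intro!: homI simp: carrier_AutoGroup conj_by_auto AutoGroup_mult conj_by_mult)
  show ?thesis
  proof (rule A.normal_invI)
    show "subgroup (Inn G) (AutoGroup G)"
      unfolding Inn_eq_image by (rule c.img_is_subgroup)
  next
    fix h i assume h: "h \<in> carrier (AutoGroup G)" and "i \<in> Inn G"
    then obtain g where g: "g \<in> carrier G" and i: "i = conj_by G g" by (auto simp: Inn_eq_image)
    have h_auto: "h \<in> auto G" using h by (simp add: carrier_AutoGroup)
    then have hom: "h \<in> hom G G" by (simp add: auto_def)
    interpret h: group_hom G G h by unfold_locales (rule hom)
    have "compose (carrier G) h (conj_by G g) = compose (carrier G) (conj_by G (h g)) h"
      using g by (auto simp: compose_def conj_by_def)
    then have "h \<otimes>\<^bsub>AutoGroup G\<^esub> i = conj_by G (h g) \<otimes>\<^bsub>AutoGroup G\<^esub> h"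
      using g h_auto by (simp add: i AutoGroup_mult conj_by_auto)
    moreover have "conj_by G (h g) \<in> carrier (AutoGroup G)"
      using g by (simp add: carrier_AutoGroup conj_by_auto)
    ultimately have "h \<otimes>\<^bsub>AutoGroup G\<^esub> i \<otimes>\<^bsub>AutoGroup G\<^esub> inv\<^bsub>AutoGroup G\<^esub> h = conj_by G (h g)"
      using h by (simp add: A.m_assoc)
    then show "h \<otimes>\<^bsub>AutoGroup G\<^esub> i \<otimes>\<^bsub>AutoGroup G\<^esub> inv\<^bsub>AutoGroup G\<^esub> h \<in> Inn G"
      using g by (simp add: Inn_eq_image)
  qed
qed

lemma out_class_mult:
  assumes "g \<in> auto G" "h \<in> auto G"
  shows "out_class G g \<otimes>\<^bsub>Out G\<^esub> out_class G h = out_class G (compose (carrier G) g h)"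
proof -
  interpret normal "Inn G" "AutoGroup G" by (rule Inn_normal)
  show ?thesis
    using assms rcos_sum[of g h]
    by (simp add: Out_def out_class_def FactGroup_def carrier_AutoGroup AutoGroup_mult)
qed

lemma out_class_compose_Inn:
  assumes "i \<in> Inn G" "h \<in> auto G"
  shows "out_class G (compose (carrier G) i h) = out_class G h"
proof -
  interpret normal "Inn G" "AutoGroup G" by (rule Inn_normal)
  have "i \<in> auto G" using assms(1) subset by (auto simp: carrier_AutoGroup)
  then have "compose (carrier G) i h \<in> Inn G #>\<^bsub>AutoGroup G\<^esub> h"
    using assms by (auto simp: r_coset_def AutoGroup_mult intro!: bexI[of _ i])
  then show ?thesis
    using assms(2) repr_independence[OF _ _ is_subgroup]
    by (simp add: out_class_def carrier_AutoGroup)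
qed

end

lemma carrier_Out: "carrier (Out G) = out_class G ` auto G"
  by (auto simp: Out_def out_class_def FactGroup_def RCOSETS_def carrier_AutoGroup)

text \<open>Factor \<open>(e, a, M) = (e, a - e * b, I) \<circ> (1, b, M)\<close>: the left factor
  is inner because \<open>a - e * b\<close> is even. So the sign disappears in
  \<open>Out G3\<close>, and of \<open>a\<close> only the parity matters.\<close>

lemma out_class_twist:
  assumes e: "e \<in> {1, - 1}" and M: "odd_cols M" "invertible M" and "even (a - b)"
  shows "out_class G3 (twist e a M) = out_class G3 (twist 1 b M)"
proof -
  have "even (a - e * b)" using assms(4) e by auto
  then obtain k where "a - e * b = 2 * k" by (elim evenE)
  then have "a = 2 * k + e * b" by simp
  then have "twist e a M = compose (carrier G3) (twist e (2 * k) (mat 1)) (twist 1 b M)"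
    by (simp add: twist_compose[OF M(1)])
  moreover have "twist e (2 * k) (mat 1) \<in> Inn G3" using e by (auto simp: Inn_G3)
  moreover have "twist 1 b M \<in> auto G3" using M by (simp add: twist_auto)
  ultimately show ?thesis by (simp only: G3.out_class_compose_Inn)
qed

lemma out_class_twist_mult:
  assumes "odd_cols M" "invertible M" "odd_cols N" "invertible N" "even (a + b - c)"
  shows "out_class G3 (twist 1 a M) \<otimes>\<^bsub>Out G3\<^esub> out_class G3 (twist 1 b N) =
    out_class G3 (twist 1 c (M ** N))"
proof -
  have "out_class G3 (twist 1 a M) \<otimes>\<^bsub>Out G3\<^esub> out_class G3 (twist 1 b N) =
      out_class G3 (twist 1 (a + b) (M ** N))"
    using assms by (simp add: G3.out_class_mult twist_auto twist_compose)
  also have "\<dots> = out_class G3 (twist 1 c (M ** N))"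
    using assms by (intro out_class_twist) (simp_all add: odd_cols_mult invertible_mult)
  finally show ?thesis .
qed

theorem theorem4p12:
  shows "auto G3 =
      {\<alpha> a A | a A. A \<in> matsA} \<union> {\<alpha> a B | a B. B \<in> matsB} \<union>
      {\<beta> a A | a A. A \<in> matsA} \<union> {\<beta> a B | a B. B \<in> matsB}
    \<and> Inn G3 = {\<alpha> (2 * a) (mat 1) | a. True} \<union> {\<beta> (2 * a) (mat 1) | a. True}
    \<and> carrier (Out G3) =
      {out_class G3 (\<alpha> 0 A) | A. A \<in> matsA} \<union> {out_class G3 (\<alpha> 1 A) | A. A \<in> matsA} \<union>
      {out_class G3 (\<alpha> 0 B) | B. B \<in> matsB} \<union> {out_class G3 (\<alpha> 1 B) | B. B \<in> matsB}
    \<and> (\<forall>M \<in> matsA \<union> matsB. \<forall>M' \<in> matsA \<union> matsB.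
        out_class G3 (\<alpha> 0 M) \<otimes>\<^bsub>Out G3\<^esub> out_class G3 (\<alpha> 0 M') = out_class G3 (\<alpha> 0 (M ** M')) \<and>
        out_class G3 (\<alpha> 0 M) \<otimes>\<^bsub>Out G3\<^esub> out_class G3 (\<alpha> 1 M') = out_class G3 (\<alpha> 1 (M ** M')) \<and>
        out_class G3 (\<alpha> 1 M) \<otimes>\<^bsub>Out G3\<^esub> out_class G3 (\<alpha> 0 M') = out_class G3 (\<alpha> 1 (M ** M')) \<and>
        out_class G3 (\<alpha> 1 M) \<otimes>\<^bsub>Out G3\<^esub> out_class G3 (\<alpha> 1 M') = out_class G3 (\<alpha> 0 (M ** M')))"
proof -
  have mats: "M \<in> matsA \<or> M \<in> matsB \<longleftrightarrow> odd_cols M \<and> invertible M" for M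
    using matsA_Un_matsB by blast
  have \<alpha>: "{\<alpha> a M | a M. M \<in> matsA \<or> M \<in> matsB} = {twist 1 a M | a M. odd_cols M \<and> invertible M}"
    unfolding mats by (rule Collect_cong) (metis \<alpha>_eq_twist)
  have \<beta>: "{\<beta> a M | a M. M \<in> matsA \<or> M \<in> matsB} = {twist (- 1) a M | a M. odd_cols M \<and> invertible M}"
    unfolding mats by (rule Collect_cong) (metis \<beta>_eq_twist)
  have "auto G3 = {\<alpha> a M | a M. M \<in> matsA \<or> M \<in> matsB} \<union> {\<beta> a M | a M. M \<in> matsA \<or> M \<in> matsB}"
    unfolding auto_G3 \<alpha> \<beta> by blast
  also have "\<dots> =
      {\<alpha> a A | a A. A \<in> matsA} \<union> {\<alpha> a B | a B. B \<in> matsB} \<union>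
      {\<beta> a A | a A. A \<in> matsA} \<union> {\<beta> a B | a B. B \<in> matsB}"
    by blast
  finally have Aut: "auto G3 = \<dots>" .
  have Inn: "Inn G3 = {\<alpha> (2 * a) (mat 1) | a. True} \<union> {\<beta> (2 * a) (mat 1) | a. True}"
    unfolding Inn_G3 \<alpha>_eq_twist[OF odd_cols_one] \<beta>_eq_twist[OF odd_cols_one] by blast
  have "carrier (Out G3) = {out_class G3 (twist e a M) | e a M.
      e \<in> {1, - 1} \<and> odd_cols M \<and> invertible M}"
    unfolding carrier_Out auto_G3 by blast
  also have "\<dots> = {out_class G3 (\<alpha> c M) | c M. c \<in> {0, 1} \<and> (M \<in> matsA \<or> M \<in> matsB)}"
    (is "?L = ?R")
  proof (intro equalityI subsetI)
    fix X assume "X \<in> ?L"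
    then obtain e a M where e: "e \<in> {1, - 1}" and M: "odd_cols M" "invertible M"
      and X: "X = out_class G3 (twist e a M)"
      by blast
    \<comment> \<open>The remainder modulo 2 is the representative of \<open>a\<close> in {0,
      1}.\<close>
    have "X = out_class G3 (\<alpha> (a mod 2) M)"
      unfolding X \<alpha>_eq_twist[OF M(1)] by (rule out_class_twist[OF e M]) presburger
    moreover have "a mod 2 = 0 \<or> a mod 2 = 1" by presburger
    ultimately have "X = out_class G3 (\<alpha> 0 M) \<or> X = out_class G3 (\<alpha> 1 M)" by metis
    then show "X \<in> ?R"
      unfolding mats using M by blast
  next
    fix X assume "X \<in> ?R"
    then obtain c M where "X = out_class G3 (\<alpha> c M)" and M: "odd_cols M" "invertible M"
      unfolding mats by blast
    then have "X = out_class G3 (twist 1 c M)" by (simp add: \<alpha>_eq_twist)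
    then show "X \<in> ?L" using M by blast
  qed
  also have "\<dots> = {out_class G3 (\<alpha> 0 A) | A. A \<in> matsA} \<union> {out_class G3 (\<alpha> 1 A) | A. A \<in> matsA} \<union>
      {out_class G3 (\<alpha> 0 B) | B. B \<in> matsB} \<union> {out_class G3 (\<alpha> 1 B) | B. B \<in> matsB}"
    by blast
  finally have Out: "carrier (Out G3) = \<dots>" .
  \<comment> \<open>All four composition rules are instances; in the last one \<open>1 + 1\<close>
    is replaced by 0, which has the same parity.\<close>
  have mult: "out_class G3 (\<alpha> a M) \<otimes>\<^bsub>Out G3\<^esub> out_class G3 (\<alpha> b M') = out_class G3 (\<alpha> c (M ** M'))"
    if "M \<in> matsA \<union> matsB" "M' \<in> matsA \<union> matsB" "even (a + b - c)" for a b c M M'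
    using that by (simp add: matsA_Un_matsB \<alpha>_eq_twist odd_cols_mult out_class_twist_mult)
  show ?thesis
    using Aut Inn Out by (intro conjI ballI mult) simp_all
qed

end
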